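(* Let $X$ be an Archimedean vector lattice with a weak unit $x_0>0$. Then for any net $(x_\alpha)$ in $X$, $x_\alpha\xrightarrow{\rm uo}0$ in $X$ if and only if $|x_\alpha|\wedge x_0\xrightarrow{\rm o}0$ in $X$.
   Context: All vector lattices are real and Archimedean. An element $x_0>0$ is a weak unit of $X$ if $|x|\wedge x_0=0$ implies $x=0$. A net $(x_\alpha)_{\alpha\in\Gamma}$ in $X$ converges in order to $x\in X$ ($x_\alpha\xrightarrow{\rm o}x$) if there is a net $(a_\gamma)_{\gamma\in\Lambda}$ in $X$ (possibly over a different index set) with $a_\gamma\downarrow 0$ such that for every $\gamma\in\Lambda$ there is $\alpha_0\in\Gamma$ with $|x_\alpha-x|\le a_\gamma$ for all $\alpha\ge\alpha_0$. The net uo-converges to $x$ ($x_\alpha\xrightarrow{\rm uo}x$) if $|x_\alpha-x|\wedge y\xrightarrow{\rm o}0$ for every $y\in X_+$. *)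

theory Defs
  imports Complex_Main "HOL-Library.Lattice_Algebras" "HOL-Library.Lub_Glb"
begin

class vector_lattice = ordered_real_vector + lattice_ab_group_add_abs

class archimedean_vector_lattice = vector_lattice +
  assumes archimedean: "(\<And>n::nat. real n *\<^sub>R x \<le> y) \<Longrightarrow> x \<le> 0"

instance real :: archimedean_vector_lattice
proof
  fix x y :: real
  assume *: "\<And>n::nat. real n *\<^sub>R x \<le> y"
  show "x \<le> 0"
  proof (rule ccontr)
    assume "\<not> x \<le> 0"
    then obtain n :: nat where "y < real n * x"
      using reals_Archimedean3[of x] by auto
    with *[of n] show False by simp
  qed
qed

definition weak_unit :: "'a::vector_lattice \<Rightarrow> bool" where
  "weak_unit e \<longleftrightarrow> 0 < e \<and> (\<forall>x. inf \<bar>x\<bar> e = 0 \<longrightarrow> x = 0)"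

(* (a, b) : r means that a precedes b. A net is a directed set (I, r) together with
   a function on I. *)
definition directed_set :: "'i set \<Rightarrow> 'i rel \<Rightarrow> bool" where
  "directed_set I r \<longleftrightarrow> I \<noteq> {} \<and> preorder_on I r \<and>
     (\<forall>a\<in>I. \<forall>b\<in>I. \<exists>c\<in>I. (a, c) \<in> r \<and> (b, c) \<in> r)"

definition net_decreases_to ::
  "'g set \<Rightarrow> 'g rel \<Rightarrow> ('g \<Rightarrow> 'a::vector_lattice) \<Rightarrow> 'a \<Rightarrow> bool" where
  "net_decreases_to J s a l \<longleftrightarrow> directed_set J s \<and>
     (\<forall>c d. (c, d) \<in> s \<longrightarrow> a d \<le> a c) \<and> isGlb UNIV (a ` J) l"

(* HOL cannot quantify existentially over the index type of the dominating net, so its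
   index set is taken to be a subset of the vector lattice itself, with any directed
   preorder. This loses nothing: order_convergesI below accepts a dominating net over
   an arbitrary directed set, of any type. *)
definition order_converges ::
  "'i set \<Rightarrow> 'i rel \<Rightarrow> ('i \<Rightarrow> 'a::vector_lattice) \<Rightarrow> 'a \<Rightarrow> bool" where
  "order_converges I r x l \<longleftrightarrow>
     (\<exists>(J :: 'a set) (s :: 'a rel) (a :: 'a \<Rightarrow> 'a). net_decreases_to J s a 0 \<and>
        (\<forall>c\<in>J. \<exists>i0\<in>I. \<forall>i\<in>I. (i0, i) \<in> r \<longrightarrow> \<bar>x i - l\<bar> \<le> a c))"

lemma order_convergesI:
  fixes J :: "'g set" and a :: "'g \<Rightarrow> 'a::vector_lattice"
  assumes a: "net_decreases_to J s a 0"
    and dom: "\<forall>c\<in>J. \<exists>i0\<in>I. \<forall>i\<in>I. (i0, i) \<in> r \<longrightarrow> \<bar>x i - l\<bar> \<le> a c"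
  shows "order_converges I r x l"
proof -
  let ?K = "a ` J" and ?t = "{(u, v). u \<in> a ` J \<and> v \<in> a ` J \<and> v \<le> u}"
  have dir: "directed_set J s" and mon: "\<And>c d. (c, d) \<in> s \<Longrightarrow> a d \<le> a c"
    and glb: "isGlb UNIV (a ` J) 0"
    using a by (auto simp: net_decreases_to_def)
  have "\<exists>w\<in>?K. (a c, w) \<in> ?t \<and> (a d, w) \<in> ?t" if "c \<in> J" "d \<in> J" for c d
  proof -
    obtain e where "e \<in> J" "(c, e) \<in> s" "(d, e) \<in> s"
      using dir \<open>c \<in> J\<close> \<open>d \<in> J\<close> unfolding directed_set_def by blast
    with mon that show ?thesis by blast
  qed
  moreover have "preorder_on ?K ?t"
    by (auto simp: preorder_on_def refl_on_def trans_def)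
  moreover have "?K \<noteq> {}"
    using dir by (auto simp: directed_set_def)
  ultimately have "directed_set ?K ?t"
    unfolding directed_set_def by (metis (no_types, lifting) imageE)
  then have "net_decreases_to ?K ?t id 0"
    using glb by (simp add: net_decreases_to_def)
  moreover have "\<forall>c\<in>?K. \<exists>i0\<in>I. \<forall>i\<in>I. (i0, i) \<in> r \<longrightarrow> \<bar>x i - l\<bar> \<le> id c"
    using dom by auto
  ultimately show ?thesis
    unfolding order_converges_def by blast
qed

definition uo_converges ::
  "'i set \<Rightarrow> 'i rel \<Rightarrow> ('i \<Rightarrow> 'a::vector_lattice) \<Rightarrow> 'a \<Rightarrow> bool" where
  "uo_converges I r x l \<longleftrightarrow>
     (\<forall>y\<ge>0. order_converges I r (\<lambda>i. inf \<bar>x i - l\<bar> y) 0)"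

end

(* For y >= 0 the eventual upper bounds of inf |x i| y form a downward directed set,
   and its infimum is 0. Indeed inf |x i| y <= n (inf |x i| x0) + sup (y - n x0) 0, so a
   lower bound z of that set is below sup (y - n x0) 0 for every n, once the first summand
   has been brought down to 0 by the dominating net. Then n (inf z x0) <= y for
   every n by induction, and z <= 0 by the Archimedean property and the weak unit. *)
theory Submission
  imports Defs
begin

text \<open>Since \<open>u\<close> is positive and \<open>t\<close> is at least 1, \<open>u\<close>
  lies below \<open>t *\<^sub>R u\<close>. So the left side divided by \<open>t\<close> is below
  both \<open>u\<close> and \<open>v\<close>; no sign condition on \<open>v\<close> enters.\<close>

lemma inf_scaleR_le_scaleR_inf:
  fixes u v :: "'a::vector_lattice"
  assumes "0 \<le> u" "1 \<le> t"
  shows "inf u (t *\<^sub>R v) \<le> t *\<^sub>R inf u v"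
proof -
  let ?k = "inf u (t *\<^sub>R v)"
  have t: "0 < t"
    using assms(2) by simp
  have "?k \<le> t *\<^sub>R u"
    using scaleR_right_mono[OF assms(2,1)] by (simp add: le_infI1)
  then have "?k /\<^sub>R t \<le> inf u v"
    by (simp add: pos_divideR_le_eq[OF t])
  then show ?thesis
    by (simp only: pos_divideR_le_eq[OF t])
qed

text \<open>The positive part of \<open>y - t *\<^sub>R v\<close> is exactly what must be added to
  \<open>t *\<^sub>R v\<close> to dominate \<open>y\<close>. Subtracting it from
  \<open>inf u y\<close> leaves something below \<open>inf u (t *\<^sub>R v)\<close>, where the
  scalar can be pulled out.\<close>

lemma inf_le_scaleR_inf_add_sup:
  fixes u v y :: "'a::vector_lattice"
  assumes "0 \<le> u" "1 \<le> t"
  shows "inf u y \<le> t *\<^sub>R inf u v + sup (y - t *\<^sub>R v) 0"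
proof -
  let ?s = "sup (y - t *\<^sub>R v) 0"
  have "inf u y \<le> u + ?s"
    by (meson add_increasing2 inf_le1 order_trans sup_ge2 order_refl)
  moreover have "inf u y \<le> t *\<^sub>R v + ?s"
  proof -
    have "y - t *\<^sub>R v \<le> ?s" by simp
    then have "y \<le> t *\<^sub>R v + ?s" by (simp only: diff_le_eq add.commute)
    then show ?thesis by (simp only: le_infI2)
  qed
  ultimately have "inf u y - ?s \<le> inf u (t *\<^sub>R v)"
    by (simp only: diff_le_eq le_inf_iff)
  also have "\<dots> \<le> t *\<^sub>R inf u v"
    using assms by (rule inf_scaleR_le_scaleR_inf)
  finally show ?thesis by (simp only: diff_le_eq)
qed

lemma weak_unit_le_zero:
  fixes e y z :: "'a::archimedean_vector_lattice"
  assumes e: "weak_unit e" and "0 \<le> y"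
    and z: "\<And>n::nat. z \<le> sup (y - real (Suc n) *\<^sub>R e) 0"
  shows "z \<le> 0"
proof -
  have e0: "0 \<le> e"
    using e by (auto simp: weak_unit_def)
  \<comment> \<open>Passing to the positive part makes \<open>?w\<close> nonnegative, as the scaling
    estimate below requires, and turns \<open>?z\<close> into its own absolute value, the form in
    which \<open>weak_unit\<close> applies.\<close>
  let ?z = "sup z 0"
  let ?w = "inf ?z e"
  have w0: "0 \<le> ?w"
    using e0 by simp
  have "real n *\<^sub>R ?w \<le> y" for n
  proof (induction n)
    case 0
    then show ?case using \<open>0 \<le> y\<close> by simp
  next
    case (Suc n)
    \<comment> \<open>The shifted index costs nothing: \<open>?w\<close> is below \<open>e\<close>,
      and the extra copy of \<open>e\<close> only enlarges the right side. The bound on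
      \<open>z\<close> then leaves room for one more \<open>?w\<close> under
      \<open>y\<close>.\<close>
    have "real n *\<^sub>R ?w \<le> real (Suc n) *\<^sub>R e"
      using w0 by (intro scaleR_mono) auto
    then have "y - real (Suc n) *\<^sub>R e \<le> y - real n *\<^sub>R ?w"
      by (rule diff_left_mono)
    moreover have "0 \<le> y - real n *\<^sub>R ?w"
      using Suc by (simp only: diff_ge_0_iff_ge)
    ultimately have "sup (y - real (Suc n) *\<^sub>R e) 0 \<le> y - real n *\<^sub>R ?w"
      by (rule sup_least)
    then have "?z \<le> y - real n *\<^sub>R ?w"
      using z[of n] \<open>0 \<le> y - real n *\<^sub>R ?w\<close> by (meson sup_least order_trans)
    then have "?w \<le> y - real n *\<^sub>R ?w"
      by (rule le_infI1)
    then show ?case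
      by (simp only: of_nat_Suc scaleR_left_distrib scaleR_one le_diff_eq)
  qed
  then have "?w \<le> 0"
    by (rule archimedean)
  then have "inf \<bar>?z\<bar> e = 0"
    using w0 by (simp add: order_antisym)
  then have "?z = 0"
    using e by (simp only: weak_unit_def)
  then show ?thesis
    by (metis sup_ge1)
qed

lemma directed_set_inf_closed:
  fixes D :: "'a::semilattice_inf set"
  assumes "D \<noteq> {}" "\<And>c d. c \<in> D \<Longrightarrow> d \<in> D \<Longrightarrow> inf c d \<in> D"
  shows "directed_set D {(c, d). c \<in> D \<and> d \<in> D \<and> d \<le> c}"
  unfolding directed_set_def
proof (intro conjI ballI)
  show "preorder_on D {(c, d). c \<in> D \<and> d \<in> D \<and> d \<le> c}"
    by (auto simp: preorder_on_def refl_on_def trans_def)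
next
  fix c d
  assume "c \<in> D" "d \<in> D"
  then show "\<exists>b\<in>D. (c, b) \<in> {(c, d). c \<in> D \<and> d \<in> D \<and> d \<le> c} \<and>
      (d, b) \<in> {(c, d). c \<in> D \<and> d \<in> D \<and> d \<le> c}"
    using assms(2) by (intro bexI[of _ "inf c d"]) auto
qed (rule assms(1))

text \<open>The eventual upper bounds themselves, indexed by the identity and ordered downwards,
  form the dominating net. Directedness of \<open>I\<close> closes \<open>D\<close> under
  \<open>inf\<close>, and reflexivity of \<open>r\<close> makes each bound dominate a value of
  \<open>f\<close>, hence 0.\<close>

lemma order_converges_zeroI:
  fixes f :: "'i \<Rightarrow> 'a::vector_lattice"
  assumes dir: "directed_set I r" and f0: "\<And>i. 0 \<le> f i"
    and D: "D = {d. \<exists>i0\<in>I. \<forall>i\<in>I. (i0, i) \<in> r \<longrightarrow> f i \<le> d}"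
    and "D \<noteq> {}" and lb: "\<And>z. (\<And>d. d \<in> D \<Longrightarrow> z \<le> d) \<Longrightarrow> z \<le> 0"
  shows "order_converges I r f 0"
proof (rule order_convergesI)
  have tr: "trans r" and rf: "refl_on I r"
    using dir by (auto simp: directed_set_def preorder_on_def)
  have "inf c d \<in> D" if c: "c \<in> D" and d: "d \<in> D" for c d
  proof -
    obtain i j where ij: "i \<in> I" "\<forall>k\<in>I. (i, k) \<in> r \<longrightarrow> f k \<le> c"
        "j \<in> I" "\<forall>k\<in>I. (j, k) \<in> r \<longrightarrow> f k \<le> d"
      using c d D by blast
    obtain l where l: "l \<in> I" "(i, l) \<in> r" "(j, l) \<in> r"
      using dir ij unfolding directed_set_def by blast
    have "f k \<le> inf c d" if "k \<in> I" "(l, k) \<in> r" for k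
      using that ij l transD[OF tr] by (metis le_inf_iff)
    with l(1) show ?thesis unfolding D by blast
  qed
  with \<open>D \<noteq> {}\<close> have dirD: "directed_set D {(c, d). c \<in> D \<and> d \<in> D \<and> d \<le> c}"
    by (rule directed_set_inf_closed)
  have "0 \<le> d" if d: "d \<in> D" for d
  proof -
    obtain i where "i \<in> I" "\<forall>k\<in>I. (i, k) \<in> r \<longrightarrow> f k \<le> d"
      using d D by blast
    then have "f i \<le> d"
      using rf by (auto simp: refl_on_def)
    with f0[of i] show ?thesis by (rule order_trans)
  qed
  then have "isGlb UNIV (id ` D) 0"
    using lb by (auto simp: isGlb_def greatestP_def isLb_def setge_def setle_def)
  with dirD show "net_decreases_to D {(c, d). c \<in> D \<and> d \<in> D \<and> d \<le> c} id 0"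
    by (simp add: net_decreases_to_def)
  show "\<forall>c\<in>D. \<exists>i0\<in>I. \<forall>i\<in>I. (i0, i) \<in> r \<longrightarrow> \<bar>f i - 0\<bar> \<le> id c"
    using f0 by (simp add: D)
qed

theorem corollary3p5:
  fixes x0 :: "'a::archimedean_vector_lattice"
    and I :: "'i set" and r :: "'i rel" and x :: "'i \<Rightarrow> 'a"
  assumes "weak_unit x0"
    and "directed_set I r"
  shows "uo_converges I r x 0 \<longleftrightarrow> order_converges I r (\<lambda>i. inf \<bar>x i\<bar> x0) 0"
proof
  have x0: "0 \<le> x0"
    using assms(1) by (auto simp: weak_unit_def)
  show "order_converges I r (\<lambda>i. inf \<bar>x i\<bar> x0) 0" if "uo_converges I r x 0"
    using that x0 by (simp add: uo_converges_def)
  assume "order_converges I r (\<lambda>i. inf \<bar>x i\<bar> x0) 0"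
  then obtain J :: "'a set" and s a where net: "net_decreases_to J s a 0"
    and dom: "\<And>c. c \<in> J \<Longrightarrow> \<exists>i0\<in>I. \<forall>i\<in>I. (i0, i) \<in> r \<longrightarrow> inf \<bar>x i\<bar> x0 \<le> a c"
    using x0 by (auto simp: order_converges_def)
  have glb: "w \<le> 0" if "\<And>c. c \<in> J \<Longrightarrow> w \<le> a c" for w
    using net that
    by (auto simp: net_decreases_to_def isGlb_def greatestP_def isLb_def setge_def setle_def)
  have "order_converges I r (\<lambda>i. inf \<bar>x i\<bar> y) 0" if y: "0 \<le> y" for y
  proof (rule order_converges_zeroI[OF assms(2) _ refl])
    show "0 \<le> inf \<bar>x i\<bar> y" for i
      using y by simp
    let ?D = "{d. \<exists>i0\<in>I. \<forall>i\<in>I. (i0, i) \<in> r \<longrightarrow> inf \<bar>x i\<bar> y \<le> d}"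
    \<comment> \<open>\<open>y\<close> bounds the truncated net at every index, so any element of
      \<open>I\<close> serves as starting point.\<close>
    have "y \<in> ?D"
      using assms(2) by (auto simp: directed_set_def)
    then show "?D \<noteq> {}" by blast
    fix z
    assume z: "\<And>d. d \<in> ?D \<Longrightarrow> z \<le> d"
    show "z \<le> 0"
    proof (rule weak_unit_le_zero[OF assms(1) y])
      fix n :: nat
      \<comment> \<open>The successor keeps the factor at least 1, as the splitting estimate
        demands, and makes division by it possible.\<close>
      let ?t = "real (Suc n)"
      let ?s = "sup (y - ?t *\<^sub>R x0) 0"
      \<comment> \<open>Solving \<open>z \<le> ?t *\<^sub>R a c + ?s\<close> for \<open>a c\<close>
        yields a lower bound of the net \<open>a\<close> independent of \<open>c\<close>, so its
        infimum 0 can be used directly.\<close>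
      have "(z - ?s) /\<^sub>R ?t \<le> a c" if "c \<in> J" for c
      proof -
        have "?t *\<^sub>R a c + ?s \<in> ?D"
        proof -
          obtain i0 where i0: "i0 \<in> I" "\<forall>i\<in>I. (i0, i) \<in> r \<longrightarrow> inf \<bar>x i\<bar> x0 \<le> a c"
            using dom[OF \<open>c \<in> J\<close>] by blast
          have "inf \<bar>x i\<bar> y \<le> ?t *\<^sub>R a c + ?s" if "i \<in> I" "(i0, i) \<in> r" for i
          proof -
            have "inf \<bar>x i\<bar> y \<le> ?t *\<^sub>R inf \<bar>x i\<bar> x0 + ?s"
              by (rule inf_le_scaleR_inf_add_sup) simp_all
            also have "\<dots> \<le> ?t *\<^sub>R a c + ?s"
              using i0 that by (intro add_right_mono scaleR_left_mono) simp_all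
            finally show ?thesis .
          qed
          with i0(1) show ?thesis by blast
        qed
        then have "z - ?s \<le> ?t *\<^sub>R a c"
          using z by (simp only: diff_le_eq)
        then show ?thesis
          by (simp only: pos_divideR_le_eq of_nat_0_less_iff zero_less_Suc)
      qed
      then have "(z - ?s) /\<^sub>R ?t \<le> 0"
        by (rule glb)
      then show "z \<le> ?s"
        by (simp only: pos_divideR_le_eq of_nat_0_less_iff zero_less_Suc scaleR_zero_right
            diff_le_0_iff_le)
    qed
  qed
  then show "uo_converges I r x 0"
    by (simp add: uo_converges_def)
qed

end
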